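(* The tableau procedure $\mathtt{TAB}_{\mathcal{ALC}\iota}$ is terminating: for every input $\mathcal{ALC}\iota$ concept $C$ (and optional $\mathcal{ALC}\iota$ ontology $\mathcal{O}$), the tableau constructed by exhaustively applying its rules is finite.
   Context: $\mathcal{ALC}\iota$ concepts: $C ::= A \mid \neg C \mid (C\sqcap C) \mid \exists r.C \mid \{\iota C\} \mid \iota C.C$. An ontology consists of a TBox (concept inclusions) and an ABox (assertions $a:C$, $r:(a,b)$). Procedure $\mathtt{TAB}_{\mathcal{ALC}\iota}$: builds a tree of assertions whose root contains $a:C$, $a$ not in $\mathcal{O}$. A branch (root-to-leaf path, treated as a set of assertions) is closed if it contains $\bot$, open otherwise. A rule $\frac{Pr}{Con_1\mid\cdots\mid Con_m}$ is applicable to $Pr$ if not blocked, no $Con_i$ is already on the branch, and the branch is open; applying it splits the branch into $m$ extensions. Rules are applied in fixed priority order ($(\bot)$ highest, $(\exists r)$ lowest). Rules ($b,b'$ fresh individuals; $A^g_C$, $A_C$ fresh atomic concepts determined by $C$): $(ABox_{\mathsf I})$: if $a:C\in$ABox add $a:C$; $(ABox_r)$: if $r(a,a')\in$ABox add $r(a,a')$; $(TBox)$: from $C\sqsubseteq D\in$TBox and $a:E$ add $a:\neg(C\sqcap\neg D)$; $(\bot)$: $a:C,a:\neg C\Rightarrow\bot$; $(\neg\neg)$: $a:\neg\neg C\Rightarrow a:C$; $(\sqcap)$: $a:C\sqcap D\Rightarrow a:C,a:D$; $(\neg\sqcap)$: $a:\neg(C\sqcap D)\Rightarrow a:\neg C\mid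 a:\neg D$; $(\exists r)$: $a:\exists r.C\Rightarrow b:C,r:(a,b)$, blocked if some individual $a'$ on the branch has $a':C$ and $a':\neg D$ for every $D$ with $a:\neg\exists r.D$ on the branch; $(\neg\exists r)$: $a:\neg\exists r.C,r:(a,a')\Rightarrow a':\neg C$; $(\iota^g_1)$: $a:\iota C.D\Rightarrow b:C,b:D$, except that if some individual already satisfies $C$ only $D$ is added to the lexicographically least such; $(\iota^g_2)$: $a:\iota C.D,a':C,a'':C,a':E\Rightarrow a'':E$; $(\neg\iota^g)$: $a:\neg\iota C.D,a':E\Rightarrow a':\neg C\mid a':\neg D\mid b:C,b:A^g_C,b':C,b':\neg A^g_C$, and once the third alternative has been taken further applications to $x:\neg\iota C.E$ are blocked; $(cut^g_\iota)$: $a:\iota C.D,a':E\Rightarrow a':C\mid a':\neg C$; $(\iota^\ell_1)$: $a:\{\iota C\}\Rightarrow a:C$; $(\iota^\ell_2)$: $a:\{\iota C\},a':C,a'':C,a':D\Rightarrow a'':D$; $(\neg\iota^\ell)$: $a:\neg\{\iota C\}\Rightarrow a:\neg C\mid a:\neg A_C,b:C,b:A_C$ (in the right alternative only $a:\neg A_C$ is added if an individual already satisfies $C$ and $A_C$); $(cut^\ell_\iota)$: $a:\{\iota C\},a':D\Rightarrow a':C\mid a':\neg C$. *)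

theory Defs
  imports Main
begin

section \<open>Syntax\<close>

text \<open>\<open>Loc C\<close> is the local description \<open>{\<iota>C}\<close> and \<open>Iota C D\<close> the global description \<open>\<iota>C.D\<close>.\<close>

datatype (atoms: 'c, roles: 'r) concept =
    Atom 'c
  | Neg "('c, 'r) concept"
  | And "('c, 'r) concept" "('c, 'r) concept"
  | Ex 'r "('c, 'r) concept"
  | Loc "('c, 'r) concept"
  | Iota "('c, 'r) concept" "('c, 'r) concept"

datatype ('c, 'r, inds: 'i) assertion =
    Inst 'i "('c, 'r) concept"
  | Rel 'r 'i 'i
  | Bot

record ('c, 'r, 'i) ontology =
  tbox :: "(('c, 'r) concept \<times> ('c, 'r) concept) set"
  abox :: "('c, 'r, 'i) assertion set"

text \<open>\<open>Bot\<close> is used on branches only and is not an ABox assertion.\<close>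

definition is_ontology :: "('c, 'r, 'i) ontology \<Rightarrow> bool" where
  "is_ontology K \<longleftrightarrow> finite (tbox K) \<and> finite (abox K) \<and> Bot \<notin> abox K"

definition ontology_inds :: "('c, 'r, 'i) ontology \<Rightarrow> 'i set" where
  "ontology_inds K = (\<Union>\<phi>\<in>abox K. inds \<phi>)"

definition ontology_atoms :: "('c, 'r, 'i) ontology \<Rightarrow> 'c set" where
  "ontology_atoms K =
     (\<Union>(C, D)\<in>tbox K. atoms C \<union> atoms D) \<union> (\<Union>{atoms C | a C. Inst a C \<in> abox K})"

text \<open>\<open>Ag C\<close> and \<open>Al C\<close> are the names of the atomic concepts \<open>A\<^sup>g\<^sub>C\<close> and \<open>A\<^sub>C\<close>.\<close>

definition fresh_names ::
  "('c, 'r) concept \<Rightarrow> ('c, 'r, 'i) ontology \<Rightarrow>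
   (('c, 'r) concept \<Rightarrow> 'c) \<Rightarrow> (('c, 'r) concept \<Rightarrow> 'c) \<Rightarrow> bool" where
  "fresh_names C\<^sub>0 K Ag Al \<longleftrightarrow>
     inj Ag \<and> inj Al \<and> range Ag \<inter> range Al = {} \<and>
     (range Ag \<union> range Al) \<inter> (atoms C\<^sub>0 \<union> ontology_atoms K) = {}"

section \<open>Rules\<close>

datatype rule_name =
    RABoxI | RABoxR | RTBox | RBot | RNegNeg | RAnd | RNegAnd | REx | RNegEx
  | RIotaG1 | RIotaG2 | RNegIotaG | RCutG
  | RIotaL1 | RIotaL2 | RNegIotaL | RCutL

definition fresh_ind ::
  "('c, 'r, 'i) ontology \<Rightarrow> ('c, 'r, 'i) assertion set \<Rightarrow> 'i \<Rightarrow> bool" where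
  "fresh_ind K B b \<longleftrightarrow> b \<notin> ontology_inds K \<and> b \<notin> (\<Union>\<phi>\<in>B. inds \<phi>)"

text \<open>
  \<open>tab_rule K Ag Al B \<rho> Pr Cs\<close>: on a branch with assertions \<open>B\<close>, the rule \<open>\<rho>\<close> has an instance
  with premises \<open>Pr\<close> and alternatives \<open>Cs\<close>. That the premises are on the branch, blocking,
  and the remaining conditions common to all rules are in \<open>applicable\<close> below. The linear order on
  individual names stands for the lexicographic one.
\<close>

inductive tab_rule ::
  "('c, 'r, 'i::linorder) ontology \<Rightarrow>
   (('c, 'r) concept \<Rightarrow> 'c) \<Rightarrow> (('c, 'r) concept \<Rightarrow> 'c) \<Rightarrow>
   ('c, 'r, 'i) assertion set \<Rightarrow> rule_name \<Rightarrow>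
   ('c, 'r, 'i) assertion list \<Rightarrow> ('c, 'r, 'i) assertion set list \<Rightarrow> bool"
  for K Ag Al B where
  ABoxI: "Inst a C \<in> abox K \<Longrightarrow>
    tab_rule K Ag Al B RABoxI [] [{Inst a C}]"
| ABoxR: "Rel r a a' \<in> abox K \<Longrightarrow>
    tab_rule K Ag Al B RABoxR [] [{Rel r a a'}]"
| TBox: "(C, D) \<in> tbox K \<Longrightarrow>
    tab_rule K Ag Al B RTBox [Inst a E] [{Inst a (Neg (And C (Neg D)))}]"
| Bot: "tab_rule K Ag Al B RBot [Inst a C, Inst a (Neg C)] [{Bot}]"
| NegNeg: "tab_rule K Ag Al B RNegNeg [Inst a (Neg (Neg C))] [{Inst a C}]"
| And: "tab_rule K Ag Al B RAnd [Inst a (And C D)] [{Inst a C, Inst a D}]"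
| NegAnd: "tab_rule K Ag Al B RNegAnd [Inst a (Neg (And C D))]
    [{Inst a (Neg C)}, {Inst a (Neg D)}]"
| Ex: "fresh_ind K B b \<Longrightarrow>
    tab_rule K Ag Al B REx [Inst a (Ex r C)] [{Inst b C, Rel r a b}]"
| NegEx: "tab_rule K Ag Al B RNegEx [Inst a (Neg (Ex r C)), Rel r a a'] [{Inst a' (Neg C)}]"
| IotaG1_new: "(\<nexists>x. Inst x C \<in> B) \<Longrightarrow> fresh_ind K B b \<Longrightarrow>
    tab_rule K Ag Al B RIotaG1 [Inst a (Iota C D)] [{Inst b C, Inst b D}]"
| IotaG1_old: "Inst x C \<in> B \<Longrightarrow> (\<forall>y. Inst y C \<in> B \<longrightarrow> x \<le> y) \<Longrightarrow>
    tab_rule K Ag Al B RIotaG1 [Inst a (Iota C D)] [{Inst x D}]"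
| IotaG2: "tab_rule K Ag Al B RIotaG2
    [Inst a (Iota C D), Inst a' C, Inst a'' C, Inst a' E] [{Inst a'' E}]"
| NegIotaG: "fresh_ind K B b \<Longrightarrow> fresh_ind K B b' \<Longrightarrow> b \<noteq> b' \<Longrightarrow>
    tab_rule K Ag Al B RNegIotaG [Inst a (Neg (Iota C D)), Inst a' E]
      [{Inst a' (Neg C)}, {Inst a' (Neg D)},
       {Inst b C, Inst b (Atom (Ag C)), Inst b' C, Inst b' (Neg (Atom (Ag C)))}]"
| CutG: "tab_rule K Ag Al B RCutG [Inst a (Iota C D), Inst a' E]
    [{Inst a' C}, {Inst a' (Neg C)}]"
| IotaL1: "tab_rule K Ag Al B RIotaL1 [Inst a (Loc C)] [{Inst a C}]"
| IotaL2: "tab_rule K Ag Al B RIotaL2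
    [Inst a (Loc C), Inst a' C, Inst a'' C, Inst a' D] [{Inst a'' D}]"
| NegIotaL_new:
    "(\<nexists>x. Inst x C \<in> B \<and> Inst x (Atom (Al C)) \<in> B) \<Longrightarrow> fresh_ind K B b \<Longrightarrow>
    tab_rule K Ag Al B RNegIotaL [Inst a (Neg (Loc C))]
      [{Inst a (Neg C)}, {Inst a (Neg (Atom (Al C))), Inst b C, Inst b (Atom (Al C))}]"
| NegIotaL_old: "Inst x C \<in> B \<Longrightarrow> Inst x (Atom (Al C)) \<in> B \<Longrightarrow>
    tab_rule K Ag Al B RNegIotaL [Inst a (Neg (Loc C))]
      [{Inst a (Neg C)}, {Inst a (Neg (Atom (Al C)))}]"
| CutL: "tab_rule K Ag Al B RCutL [Inst a (Loc C), Inst a' D]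
    [{Inst a' C}, {Inst a' (Neg C)}]"

section \<open>Tableaux\<close>

text \<open>
  A step is one edge of the tree: the rule applied, the premises it was applied to, the number
  (from 0) of the alternative followed, and the assertions of that alternative. A node is the list
  of the steps leading to it from the root, and a tree is a prefix-closed set of nodes.
\<close>

datatype ('c, 'r, 'i) step =
  Step (step_rule: rule_name) (step_prems: "('c, 'r, 'i) assertion list") (step_alt: nat)
    (step_concl: "('c, 'r, 'i) assertion set")

type_synonym ('c, 'r, 'i) node = "('c, 'r, 'i) step list"

definition branch ::
  "'i \<Rightarrow> ('c, 'r) concept \<Rightarrow> ('c, 'r, 'i) node \<Rightarrow> ('c, 'r, 'i) assertion set" where
  "branch a\<^sub>0 C\<^sub>0 \<pi> = {Inst a\<^sub>0 C\<^sub>0} \<union> (\<Union>s\<in>set \<pi>. step_concl s)"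

text \<open>The third alternative of the \<open>(\<not>\<iota>\<^sup>g)\<close> rule has been taken for \<open>C\<close> on the way to \<open>\<pi>\<close>.\<close>

definition third_taken :: "('c, 'r, 'i) node \<Rightarrow> ('c, 'r) concept \<Rightarrow> bool" where
  "third_taken \<pi> C \<longleftrightarrow>
     (\<exists>s\<in>set \<pi>. step_rule s = RNegIotaG \<and> step_alt s = 2 \<and>
        (\<exists>a D. hd (step_prems s) = Inst a (Neg (Iota C D))))"

definition blocked ::
  "'i \<Rightarrow> ('c, 'r) concept \<Rightarrow> ('c, 'r, 'i) node \<Rightarrow> rule_name \<Rightarrow>
   ('c, 'r, 'i) assertion list \<Rightarrow> bool" where
  "blocked a\<^sub>0 C\<^sub>0 \<pi> \<rho> Pr \<longleftrightarrow>
     (\<rho> = REx \<and>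
       (\<exists>a r C a'. Pr = [Inst a (Ex r C)] \<and> Inst a' C \<in> branch a\<^sub>0 C\<^sub>0 \<pi> \<and>
         (\<forall>D. Inst a (Neg (Ex r D)) \<in> branch a\<^sub>0 C\<^sub>0 \<pi> \<longrightarrow> Inst a' (Neg D) \<in> branch a\<^sub>0 C\<^sub>0 \<pi>))) \<or>
     (\<rho> = RNegIotaG \<and>
       (\<exists>a C D. hd Pr = Inst a (Neg (Iota C D)) \<and> third_taken \<pi> C))"

definition applicable ::
  "('c, 'r, 'i::linorder) ontology \<Rightarrow>
   (('c, 'r) concept \<Rightarrow> 'c) \<Rightarrow> (('c, 'r) concept \<Rightarrow> 'c) \<Rightarrow>
   'i \<Rightarrow> ('c, 'r) concept \<Rightarrow> ('c, 'r, 'i) node \<Rightarrow> rule_name \<Rightarrow>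
   ('c, 'r, 'i) assertion list \<Rightarrow> ('c, 'r, 'i) assertion set list \<Rightarrow> bool" where
  "applicable K Ag Al a\<^sub>0 C\<^sub>0 \<pi> \<rho> Pr Cs \<longleftrightarrow>
     tab_rule K Ag Al (branch a\<^sub>0 C\<^sub>0 \<pi>) \<rho> Pr Cs \<and>
     set Pr \<subseteq> branch a\<^sub>0 C\<^sub>0 \<pi> \<and>
     \<not> blocked a\<^sub>0 C\<^sub>0 \<pi> \<rho> Pr \<and>
     (\<forall>Con\<in>set Cs. \<not> Con \<subseteq> branch a\<^sub>0 C\<^sub>0 \<pi>) \<and>
     Bot \<notin> branch a\<^sub>0 C\<^sub>0 \<pi>"

text \<open>
  A priority order is given by ranks, rules of smaller rank being applied first. Only the two ends
  of the order are prescribed.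
\<close>

definition priority_order :: "(rule_name \<Rightarrow> nat) \<Rightarrow> bool" where
  "priority_order rank \<longleftrightarrow>
     (\<forall>\<rho>. \<rho> \<noteq> RBot \<longrightarrow> rank RBot < rank \<rho>) \<and> (\<forall>\<rho>. \<rho> \<noteq> REx \<longrightarrow> rank \<rho> < rank REx)"

definition next_rule ::
  "(rule_name \<Rightarrow> nat) \<Rightarrow> ('c, 'r, 'i::linorder) ontology \<Rightarrow>
   (('c, 'r) concept \<Rightarrow> 'c) \<Rightarrow> (('c, 'r) concept \<Rightarrow> 'c) \<Rightarrow>
   'i \<Rightarrow> ('c, 'r) concept \<Rightarrow> ('c, 'r, 'i) node \<Rightarrow> rule_name \<Rightarrow>
   ('c, 'r, 'i) assertion list \<Rightarrow> ('c, 'r, 'i) assertion set list \<Rightarrow> bool" where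
  "next_rule rank K Ag Al a\<^sub>0 C\<^sub>0 \<pi> \<rho> Pr Cs \<longleftrightarrow>
     applicable K Ag Al a\<^sub>0 C\<^sub>0 \<pi> \<rho> Pr Cs \<and>
     (\<forall>\<rho>' Pr' Cs'. applicable K Ag Al a\<^sub>0 C\<^sub>0 \<pi> \<rho>' Pr' Cs' \<longrightarrow> rank \<rho> \<le> rank \<rho>')"

definition children :: "('c, 'r, 'i) node set \<Rightarrow> ('c, 'r, 'i) node \<Rightarrow> ('c, 'r, 'i) step set" where
  "children T \<pi> = {s. \<pi> @ [s] \<in> T}"

text \<open>Tableaux, and in particular exhaustively expanded ones, may a priori be infinite.\<close>

definition tableau ::
  "(rule_name \<Rightarrow> nat) \<Rightarrow> ('c, 'r, 'i::linorder) ontology \<Rightarrow>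
   (('c, 'r) concept \<Rightarrow> 'c) \<Rightarrow> (('c, 'r) concept \<Rightarrow> 'c) \<Rightarrow>
   'i \<Rightarrow> ('c, 'r) concept \<Rightarrow> ('c, 'r, 'i) node set \<Rightarrow> bool" where
  "tableau rank K Ag Al a\<^sub>0 C\<^sub>0 T \<longleftrightarrow>
     [] \<in> T \<and> (\<forall>\<pi> s. \<pi> @ [s] \<in> T \<longrightarrow> \<pi> \<in> T) \<and>
     (\<forall>\<pi>\<in>T. children T \<pi> \<noteq> {} \<longrightarrow>
        (\<exists>\<rho> Pr Cs. next_rule rank K Ag Al a\<^sub>0 C\<^sub>0 \<pi> \<rho> Pr Cs \<and>
           children T \<pi> = {Step \<rho> Pr i (Cs ! i) | i. i < length Cs}))"

definition exhaustive ::
  "('c, 'r, 'i::linorder) ontology \<Rightarrow>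
   (('c, 'r) concept \<Rightarrow> 'c) \<Rightarrow> (('c, 'r) concept \<Rightarrow> 'c) \<Rightarrow>
   'i \<Rightarrow> ('c, 'r) concept \<Rightarrow> ('c, 'r, 'i) node set \<Rightarrow> bool" where
  "exhaustive K Ag Al a\<^sub>0 C\<^sub>0 T \<longleftrightarrow>
     (\<forall>\<pi>\<in>T. children T \<pi> = {} \<longrightarrow> (\<nexists>\<rho> Pr Cs. applicable K Ag Al a\<^sub>0 C\<^sub>0 \<pi> \<rho> Pr Cs))"

lemma exhaustive_tableau_exists:
  "\<exists>T. tableau rank K Ag Al a\<^sub>0 C\<^sub>0 T \<and> exhaustive K Ag Al a\<^sub>0 C\<^sub>0 T"
proof -
  let ?app = "\<lambda>\<pi> (\<rho>, Pr, Cs). applicable K Ag Al a\<^sub>0 C\<^sub>0 \<pi> \<rho> Pr Cs"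
  let ?next = "\<lambda>\<pi> (\<rho>, Pr, Cs). next_rule rank K Ag Al a\<^sub>0 C\<^sub>0 \<pi> \<rho> Pr Cs"
  define sel where "sel \<pi> = (SOME x. ?next \<pi> x)" for \<pi>
  have ex_next: "\<exists>x. ?next \<pi> x" if "?app \<pi> x" for \<pi> x
  proof -
    from ex_has_least_nat[of "?app \<pi>" x "\<lambda>(\<rho>, _). rank \<rho>"] that
    obtain y where "?app \<pi> y" "\<forall>z. ?app \<pi> z \<longrightarrow> rank (fst y) \<le> rank (fst z)"
      by (auto simp: case_prod_unfold)
    then show ?thesis by (intro exI[of _ y]) (auto simp: next_rule_def split: prod.splits)
  qed
  define ok where "ok \<pi> s \<longleftrightarrow> (\<exists>\<rho> Pr Cs i. (\<exists>x. ?next \<pi> x) \<and> sel \<pi> = (\<rho>, Pr, Cs) \<and>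
    i < length Cs \<and> s = Step \<rho> Pr i (Cs ! i))" for \<pi> s
  define T where "T = {\<pi>. \<forall>n < length \<pi>. ok (take n \<pi>) (\<pi> ! n)}"
  have snoc: "\<pi> @ [s] \<in> T \<longleftrightarrow> \<pi> \<in> T \<and> ok \<pi> s" for \<pi> s
    unfolding T_def by (auto simp: nth_append less_Suc_eq)
  have ch: "children T \<pi> = {s. ok \<pi> s}" if "\<pi> \<in> T" for \<pi>
    using that by (simp add: children_def snoc)
  have sel: "?next \<pi> (sel \<pi>)" if "\<exists>x. ?next \<pi> x" for \<pi>
    using that unfolding sel_def by (rule someI_ex)
  have "tableau rank K Ag Al a\<^sub>0 C\<^sub>0 T"
    unfolding tableau_def
  proof (intro conjI ballI impI allI)
    show "[] \<in> T" by (simp add: T_def)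
    show "\<pi> \<in> T" if "\<pi> @ [s] \<in> T" for \<pi> s using that by (simp add: snoc)
    fix \<pi> assume T: "\<pi> \<in> T" and ne: "children T \<pi> \<noteq> {}"
    from ne obtain s where "ok \<pi> s" by (auto simp: ch[OF T])
    then obtain \<rho> Pr Cs where x: "\<exists>x. ?next \<pi> x" "sel \<pi> = (\<rho>, Pr, Cs)"
      unfolding ok_def by blast
    with sel[OF x(1)] have "next_rule rank K Ag Al a\<^sub>0 C\<^sub>0 \<pi> \<rho> Pr Cs" by simp
    moreover have "children T \<pi> = {Step \<rho> Pr i (Cs ! i) | i. i < length Cs}"
      unfolding ch[OF T] ok_def using x by auto
    ultimately show "\<exists>\<rho> Pr Cs. next_rule rank K Ag Al a\<^sub>0 C\<^sub>0 \<pi> \<rho> Pr Cs \<and>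
      children T \<pi> = {Step \<rho> Pr i (Cs ! i) | i. i < length Cs}" by blast
  qed
  moreover have "exhaustive K Ag Al a\<^sub>0 C\<^sub>0 T"
    unfolding exhaustive_def
  proof (intro ballI impI notI)
    fix \<pi> assume T: "\<pi> \<in> T" and leaf: "children T \<pi> = {}"
      and "\<exists>\<rho> Pr Cs. applicable K Ag Al a\<^sub>0 C\<^sub>0 \<pi> \<rho> Pr Cs"
    then have x: "\<exists>x. ?next \<pi> x" using ex_next by fastforce
    obtain \<rho> Pr Cs where s: "sel \<pi> = (\<rho>, Pr, Cs)" by (cases "sel \<pi>") auto
    with sel[OF x] have "tab_rule K Ag Al (branch a\<^sub>0 C\<^sub>0 \<pi>) \<rho> Pr Cs"
      by (simp add: next_rule_def applicable_def)
    then have "0 < length Cs" by cases auto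
    with s x have "ok \<pi> (Step \<rho> Pr 0 (Cs ! 0))" unfolding ok_def by blast
    with leaf show False by (auto simp: ch[OF T])
  qed
  ultimately show ?thesis by blast
qed

end

theory Submission
  imports Defs
begin

text \<open>
  Every concept on a branch belongs to a fixed finite closure of the input, and every step adds a
  new assertion to the branch, so it suffices to bound the number of individuals on a branch. To
  each branch we attach a set of keys from a fixed finite supply that grows along the branch; every
  step that introduces individuals introduces at most two of them and strictly enlarges the set of
  keys. For \<open>(\<exists>r)\<close> applied to \<open>a : \<exists>r.C\<close>, the key consists of \<open>r\<close>, \<open>C\<close> and the set \<open>N\<close> of all \<open>D\<close>
  with \<open>a : \<not>\<exists>r.D\<close> on the branch: since \<open>(\<exists>r)\<close> has the lowest priority, \<open>(\<not>\<exists>r)\<close> is saturated when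
  it is applied, so a successor created earlier with the same key would block the application.
\<close>

section \<open>The finite closure of the input\<close>

primrec subs :: "('c, 'r) concept \<Rightarrow> ('c, 'r) concept set" where
  "subs (Atom A) = {Atom A}"
| "subs (Neg C) = insert (Neg C) (subs C)"
| "subs (And C D) = insert (And C D) (subs C \<union> subs D)"
| "subs (Ex r C) = insert (Ex r C) (subs C)"
| "subs (Loc C) = insert (Loc C) (subs C)"
| "subs (Iota C D) = insert (Iota C D) (subs C \<union> subs D)"

lemma subs_refl [simp]: "C \<in> subs C"
  by (cases C) auto

lemma subs_trans: "E \<in> subs D \<Longrightarrow> D \<in> subs C \<Longrightarrow> E \<in> subs C"
  by (induction C) auto

lemma finite_subs [simp]: "finite (subs C)"
  by (induction C) auto

lemma finite_inds [simp]: "finite (inds \<phi>)"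
  by (cases \<phi>) auto

text \<open>A TBox inclusion enters in the internalised form that the rule \<open>RTBox\<close>
  adds, so its decomposition is covered by subconcepts alone.\<close>

definition seeds :: "('c, 'r) concept \<Rightarrow> ('c, 'r, 'i) ontology \<Rightarrow> ('c, 'r) concept set" where
  "seeds C\<^sub>0 K = {C\<^sub>0} \<union> (\<lambda>(C, D). Neg (And C (Neg D))) ` tbox K \<union> {C. \<exists>a. Inst a C \<in> abox K}"

definition base :: "('c, 'r) concept \<Rightarrow> ('c, 'r, 'i) ontology \<Rightarrow> ('c, 'r) concept set" where
  "base C\<^sub>0 K = (\<Union>C\<in>seeds C\<^sub>0 K. subs C)"

definition base_roles :: "('c, 'r) concept \<Rightarrow> ('c, 'r, 'i) ontology \<Rightarrow> 'r set" where
  "base_roles C\<^sub>0 K = {r. \<exists>C. Ex r C \<in> base C\<^sub>0 K} \<union> {r. \<exists>a b. Rel r a b \<in> abox K}"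

lemma finite_seeds: "is_ontology K \<Longrightarrow> finite (seeds C\<^sub>0 K)"
proof -
  assume K: "is_ontology K"
  \<comment> \<open>The \<open>case\<close> is undefined on the other constructors. This is
    harmless, since only an inclusion in the image is needed.\<close>
  have "{C. \<exists>a. Inst a C \<in> abox K} \<subseteq> (\<lambda>\<phi>. case \<phi> of Inst a C \<Rightarrow> C) ` abox K"
    by (force simp: image_iff intro: bexI[rotated])
  then have "finite {C. \<exists>a. Inst a C \<in> abox K}"
    by (rule finite_subset) (use K in \<open>simp add: is_ontology_def\<close>)
  then show ?thesis
    using K by (simp add: seeds_def is_ontology_def)
qed

lemma finite_base: "is_ontology K \<Longrightarrow> finite (base C\<^sub>0 K)"
  by (simp add: base_def finite_seeds)

lemma finite_base_roles: "is_ontology K \<Longrightarrow> finite (base_roles C\<^sub>0 K)"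
proof -
  assume K: "is_ontology K"
  have "{r. \<exists>C. Ex r C \<in> base C\<^sub>0 K} \<subseteq> (\<lambda>X. case X of Ex r C \<Rightarrow> r) ` base C\<^sub>0 K"
    by (force simp: image_iff intro: bexI[rotated])
  then have "finite {r. \<exists>C. Ex r C \<in> base C\<^sub>0 K}"
    by (rule finite_subset) (simp add: finite_base[OF K])
  moreover have "{r. \<exists>a b. Rel r a b \<in> abox K} \<subseteq> (\<lambda>\<phi>. case \<phi> of Rel r a b \<Rightarrow> r) ` abox K"
    by (force simp: image_iff intro: bexI[rotated])
  then have "finite {r. \<exists>a b. Rel r a b \<in> abox K}"
    by (rule finite_subset) (use K in \<open>simp add: is_ontology_def\<close>)
  ultimately show ?thesis
    by (simp add: base_roles_def)
qed

lemma base_subs: "C \<in> base C\<^sub>0 K \<Longrightarrow> D \<in> subs C \<Longrightarrow> D \<in> base C\<^sub>0 K"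
  unfolding base_def by (auto intro: subs_trans)

lemma base_dest:
  "Neg C \<in> base C\<^sub>0 K \<Longrightarrow> C \<in> base C\<^sub>0 K"
  "And C D \<in> base C\<^sub>0 K \<Longrightarrow> C \<in> base C\<^sub>0 K \<and> D \<in> base C\<^sub>0 K"
  "Ex r C \<in> base C\<^sub>0 K \<Longrightarrow> C \<in> base C\<^sub>0 K \<and> r \<in> base_roles C\<^sub>0 K"
  "Loc C \<in> base C\<^sub>0 K \<Longrightarrow> C \<in> base C\<^sub>0 K"
  "Iota C D \<in> base C\<^sub>0 K \<Longrightarrow> C \<in> base C\<^sub>0 K \<and> D \<in> base C\<^sub>0 K"
  by (auto intro: base_subs simp: base_roles_def)

lemma seeds_base: "C \<in> seeds C\<^sub>0 K \<Longrightarrow> C \<in> base C\<^sub>0 K"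
  by (auto simp: base_def intro: bexI[of _ C])

text \<open>One layer of negation suffices: apart from concepts already in \<open>base\<close>, the
  rules put \<open>Neg\<close> only in front of members of \<open>base\<close> and of the marker
  atoms.\<close>

definition clos ::
  "('c, 'r) concept \<Rightarrow> ('c, 'r, 'i) ontology \<Rightarrow> (('c, 'r) concept \<Rightarrow> 'c) \<Rightarrow>
   (('c, 'r) concept \<Rightarrow> 'c) \<Rightarrow> ('c, 'r) concept set" where
  "clos C\<^sub>0 K Ag Al =
     (let X = base C\<^sub>0 K \<union> (Atom \<circ> Ag) ` base C\<^sub>0 K \<union> (Atom \<circ> Al) ` base C\<^sub>0 K in X \<union> Neg ` X)"

lemma finite_clos: "is_ontology K \<Longrightarrow> finite (clos C\<^sub>0 K Ag Al)"
  by (simp add: clos_def Let_def finite_base)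

lemma clos_intros:
  "C \<in> base C\<^sub>0 K \<Longrightarrow> C \<in> clos C\<^sub>0 K Ag Al"
  "C \<in> base C\<^sub>0 K \<Longrightarrow> Neg C \<in> clos C\<^sub>0 K Ag Al"
  "C \<in> base C\<^sub>0 K \<Longrightarrow> Atom (Ag C) \<in> clos C\<^sub>0 K Ag Al"
  "C \<in> base C\<^sub>0 K \<Longrightarrow> Neg (Atom (Ag C)) \<in> clos C\<^sub>0 K Ag Al"
  "C \<in> base C\<^sub>0 K \<Longrightarrow> Atom (Al C) \<in> clos C\<^sub>0 K Ag Al"
  "C \<in> base C\<^sub>0 K \<Longrightarrow> Neg (Atom (Al C)) \<in> clos C\<^sub>0 K Ag Al"
  by (auto simp: clos_def Let_def)

text \<open>The marker concepts are atomic, so a compound concept in \<open>clos\<close> stems from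
  \<open>base\<close>, possibly under one negation. Its components therefore lie in
  \<open>base\<close> itself, and negating or marking them stays within \<open>clos\<close>.\<close>

lemma clos_dest:
  "Neg (Neg C) \<in> clos C\<^sub>0 K Ag Al \<Longrightarrow> C \<in> base C\<^sub>0 K"
  "And C D \<in> clos C\<^sub>0 K Ag Al \<Longrightarrow> C \<in> base C\<^sub>0 K \<and> D \<in> base C\<^sub>0 K"
  "Neg (And C D) \<in> clos C\<^sub>0 K Ag Al \<Longrightarrow> C \<in> base C\<^sub>0 K \<and> D \<in> base C\<^sub>0 K"
  "Ex r C \<in> clos C\<^sub>0 K Ag Al \<Longrightarrow> C \<in> base C\<^sub>0 K \<and> r \<in> base_roles C\<^sub>0 K"
  "Neg (Ex r C) \<in> clos C\<^sub>0 K Ag Al \<Longrightarrow> C \<in> base C\<^sub>0 K"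
  "Loc C \<in> clos C\<^sub>0 K Ag Al \<Longrightarrow> C \<in> base C\<^sub>0 K"
  "Neg (Loc C) \<in> clos C\<^sub>0 K Ag Al \<Longrightarrow> C \<in> base C\<^sub>0 K"
  "Iota C D \<in> clos C\<^sub>0 K Ag Al \<Longrightarrow> C \<in> base C\<^sub>0 K \<and> D \<in> base C\<^sub>0 K"
  "Neg (Iota C D) \<in> clos C\<^sub>0 K Ag Al \<Longrightarrow> C \<in> base C\<^sub>0 K \<and> D \<in> base C\<^sub>0 K"
  by (auto simp: clos_def Let_def dest: base_dest)

section \<open>Keys of a branch\<close>

text \<open>There is one constructor for each of the four rules that can introduce fresh
  individuals.\<close>

datatype ('c, 'r) key =
    KIotaG "('c, 'r) concept"
  | KNegIotaG "('c, 'r) concept"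
  | KNegIotaL "('c, 'r) concept"
  | KEx 'r "('c, 'r) concept" "('c, 'r) concept set"

lemma branch_Nil [simp]: "branch a\<^sub>0 C\<^sub>0 [] = {Inst a\<^sub>0 C\<^sub>0}"
  by (simp add: branch_def)

lemma branch_snoc [simp]: "branch a\<^sub>0 C\<^sub>0 (\<pi> @ [s]) = branch a\<^sub>0 C\<^sub>0 \<pi> \<union> step_concl s"
  by (auto simp: branch_def)

locale alci_tableau =
  fixes C\<^sub>0 :: "('c, 'r) concept"
    and K :: "('c, 'r, 'i::linorder) ontology"
    and a\<^sub>0 :: 'i
    and Ag Al :: "('c, 'r) concept \<Rightarrow> 'c"
    and rank :: "rule_name \<Rightarrow> nat"
    and T :: "('c, 'r, 'i) node set"
  assumes ontology: "is_ontology K"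
    and priority: "priority_order rank"
    and tableau: "tableau rank K Ag Al a\<^sub>0 C\<^sub>0 T"
begin

abbreviation "br \<equiv> branch a\<^sub>0 C\<^sub>0"
abbreviation "cl \<equiv> clos C\<^sub>0 K Ag Al"
abbreviation "rl \<equiv> base_roles C\<^sub>0 K"

lemmas cl_intros = clos_intros[where C\<^sub>0 = C\<^sub>0 and K = K and Ag = Ag and Al = Al]
lemmas cl_dest = clos_dest[where C\<^sub>0 = C\<^sub>0 and K = K and Ag = Ag and Al = Al]

text \<open>The universe of possible assertions depends on a set of individuals because the concepts
  and roles are bounded in advance, the individuals only later.\<close>

definition ok_assertions :: "'i set \<Rightarrow> ('c, 'r, 'i) assertion set" where
  "ok_assertions I =
     case_prod Inst ` (I \<times> cl) \<union> (\<lambda>(r, a, b). Rel r a b) ` (rl \<times> I \<times> I) \<union> {Bot}"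

lemma ok_assertions_iff [simp]:
  "Inst a C \<in> ok_assertions I \<longleftrightarrow> a \<in> I \<and> C \<in> cl"
  "Rel r a b \<in> ok_assertions I \<longleftrightarrow> r \<in> rl \<and> a \<in> I \<and> b \<in> I"
  "Bot \<in> ok_assertions I"
  by (auto simp: ok_assertions_def image_iff)

text \<open>The individuals of the ontology are counted from the root on, so that the ABox rules
  never add to this set.\<close>

definition known_inds :: "('c, 'r, 'i) node \<Rightarrow> 'i set" where
  "known_inds \<pi> = ontology_inds K \<union> (\<Union>\<phi>\<in>br \<pi>. inds \<phi>)"

definition all_keys :: "('c, 'r) key set" where
  "all_keys = KIotaG ` cl \<union> KNegIotaG ` cl \<union> KNegIotaL ` cl \<union>
     (\<lambda>(r, C, N). KEx r C N) ` (rl \<times> cl \<times> Pow cl)"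

text \<open>
  In \<open>KEx r C N\<close> the set \<open>N\<close> is only required to be contained in \<open>{D. a : \<not>\<exists>r.D}\<close>; with equality the
  keys would not be monotone along a branch.
\<close>

definition keys :: "('c, 'r, 'i) node \<Rightarrow> ('c, 'r) key set" where
  "keys \<pi> = all_keys \<inter>
     ({KIotaG C | C x. Inst x C \<in> br \<pi>} \<union>
      {KNegIotaG C | C. third_taken \<pi> C} \<union>
      {KNegIotaL C | C x. Inst x C \<in> br \<pi> \<and> Inst x (Atom (Al C)) \<in> br \<pi>} \<union>
      {KEx r C N | r C N a b. Inst b C \<in> br \<pi> \<and> Rel r a b \<in> br \<pi> \<and>
         (\<forall>D\<in>N. Inst a (Neg (Ex r D)) \<in> br \<pi>)})"

lemma finite_all_keys: "finite all_keys"
  using ontology by (simp add: all_keys_def finite_clos finite_base_roles)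

lemma keys_subset: "keys \<pi> \<subseteq> all_keys"
  by (auto simp: keys_def)

lemma keys_iff:
  "KIotaG C \<in> keys \<pi> \<longleftrightarrow> C \<in> cl \<and> (\<exists>x. Inst x C \<in> br \<pi>)"
  "KNegIotaG C \<in> keys \<pi> \<longleftrightarrow> C \<in> cl \<and> third_taken \<pi> C"
  "KNegIotaL C \<in> keys \<pi> \<longleftrightarrow>
     C \<in> cl \<and> (\<exists>x. Inst x C \<in> br \<pi> \<and> Inst x (Atom (Al C)) \<in> br \<pi>)"
  "KEx r C N \<in> keys \<pi> \<longleftrightarrow> r \<in> rl \<and> C \<in> cl \<and> N \<subseteq> cl \<and>
     (\<exists>a b. Inst b C \<in> br \<pi> \<and> Rel r a b \<in> br \<pi> \<and> (\<forall>D\<in>N. Inst a (Neg (Ex r D)) \<in> br \<pi>))"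
  by (auto simp: keys_def all_keys_def image_iff)

text \<open>Each key asks only for assertions on the branch or steps on the path to be present,
  never to be absent.\<close>

lemma keys_mono: "keys \<pi> \<subseteq> keys (\<pi> @ [s])"
proof
  fix k assume "k \<in> keys \<pi>"
  then show "k \<in> keys (\<pi> @ [s])"
    by (cases k; simp add: keys_iff third_taken_def; blast)
qed

lemma finite_ontology_inds: "finite (ontology_inds K)"
  using ontology by (auto simp: ontology_inds_def is_ontology_def)

section \<open>One step of the procedure\<close>

text \<open>The individuals of the conclusion are added to \<open>I\<close> outright, so only
  concepts and roles need checking, rule by rule, through \<open>cl_dest\<close> and
  \<open>cl_intros\<close>.\<close>

lemma ok_step:
  assumes rule: "tab_rule K Ag Al B \<rho> Pr Cs"
    and Pr: "set Pr \<subseteq> B"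
    and ok: "B \<subseteq> ok_assertions I"
    and Con: "Con \<in> set Cs"
  shows "Con \<subseteq> ok_assertions (I \<union> \<Union> (inds ` Con))"
proof -
  have P: "\<And>a C. Inst a C \<in> B \<Longrightarrow> a \<in> I \<and> C \<in> cl"
    "\<And>r a b. Rel r a b \<in> B \<Longrightarrow> r \<in> rl \<and> a \<in> I \<and> b \<in> I"
    using ok by auto
  have seed: "Neg (And C (Neg D)) \<in> cl" if "(C, D) \<in> tbox K" for C D
    using that by (intro cl_intros(1) seeds_base) (force simp: seeds_def)
  have abI: "C \<in> cl" if "Inst a C \<in> abox K" for a C
    using that by (intro cl_intros(1) seeds_base) (auto simp: seeds_def)
  have abR: "r \<in> rl" if "Rel r a b \<in> abox K" for r a b
    using that by (auto simp: base_roles_def)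
  from rule show ?thesis
    by cases (use Pr Con in \<open>auto dest!: P cl_dest intro: cl_intros seed abI abR\<close>)
qed

text \<open>The new key was absent before the step for a different reason in each rule: a negative
  side condition for \<open>RIotaG1\<close> and \<open>RNegIotaL\<close>, blocking after the third
  alternative for \<open>RNegIotaG\<close>, and blocking combined with lowest priority for
  \<open>REx\<close>. Two individuals are allowed for because of \<open>RNegIotaG\<close>.\<close>

lemma inds_step:
  assumes nxt: "next_rule rank K Ag Al a\<^sub>0 C\<^sub>0 \<pi> \<rho> Pr Cs"
    and i: "i < length Cs"
    and ok: "br \<pi> \<subseteq> ok_assertions (known_inds \<pi>)"
  defines "\<pi>' \<equiv> \<pi> @ [Step \<rho> Pr i (Cs ! i)]"
  shows "known_inds \<pi>' \<subseteq> known_inds \<pi> \<or>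
    (\<exists>b b'. known_inds \<pi>' \<subseteq> known_inds \<pi> \<union> {b, b'}) \<and> (\<exists>k. k \<in> keys \<pi>' - keys \<pi>)"
proof -
  from nxt have rule: "tab_rule K Ag Al (br \<pi>) \<rho> Pr Cs" and Pr: "set Pr \<subseteq> br \<pi>"
    and nblk: "\<not> blocked a\<^sub>0 C\<^sub>0 \<pi> \<rho> Pr" and op: "Bot \<notin> br \<pi>"
    by (auto simp: next_rule_def applicable_def)
  have P: "\<And>a C. Inst a C \<in> br \<pi> \<Longrightarrow> a \<in> known_inds \<pi> \<and> C \<in> cl"
    "\<And>r a b. Rel r a b \<in> br \<pi> \<Longrightarrow> r \<in> rl \<and> a \<in> known_inds \<pi> \<and> b \<in> known_inds \<pi>"
    using ok by auto
  have br': "br \<pi>' = br \<pi> \<union> Cs ! i"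
    by (simp add: \<pi>'_def)
  have ki: "known_inds \<pi>' = known_inds \<pi> \<union> \<Union> (inds ` (Cs ! i))"
    by (auto simp: known_inds_def br')
  have abox_inds: "inds \<phi> \<subseteq> known_inds \<pi>" if "\<phi> \<in> abox K" for \<phi>
    using that by (auto simp: known_inds_def ontology_inds_def)
  from rule show ?thesis
  proof cases
    case (ABoxI a C)
    then show ?thesis using i abox_inds[of "Inst a C"] by (auto simp: ki)
  next
    case (ABoxR r a b)
    then show ?thesis using i abox_inds[of "Rel r a b"] by (auto simp: ki)
  next
    case (Ex b a r C)
    \<comment> \<open>The largest admissible set is chosen, so that an earlier occurrence of the key
      meets the whole blocking condition for \<open>a\<close>.\<close>
    define N where "N = {D. Inst a (Neg (Ex r D)) \<in> br \<pi>}"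
    from Ex Pr have a: "Inst a (Ex r C) \<in> br \<pi>" by simp
    from P(1)[OF a] have rC: "r \<in> rl" "C \<in> cl" by (auto dest: cl_dest intro: cl_intros)
    have N: "N \<subseteq> cl" unfolding N_def by (auto dest!: P cl_dest intro: cl_intros)
    have concl: "Cs ! i = {Inst b C, Rel r a b}" using i Ex by simp
    have "KEx r C N \<in> keys \<pi>'"
      using rC N by (auto simp: keys_iff br' concl N_def)
    moreover have "KEx r C N \<notin> keys \<pi>"
    proof
      assume "KEx r C N \<in> keys \<pi>"
      then obtain a1 b1 where b1: "Inst b1 C \<in> br \<pi>" "Rel r a1 b1 \<in> br \<pi>"
        and a1: "\<And>D. D \<in> N \<Longrightarrow> Inst a1 (Neg (Ex r D)) \<in> br \<pi>"
        by (auto simp: keys_iff)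
      \<comment> \<open>Here \<open>b1\<close> may be a successor of some \<open>a1\<close> other
        than \<open>a\<close>. If the assertion were missing, \<open>RNegEx\<close> would be
        applicable to \<open>a1\<close> and \<open>b1\<close>, contradicting the choice of
        \<open>REx\<close>, which has the largest rank. Hence \<open>b1\<close> serves as the
        blocking individual.\<close>
      have "Inst b1 (Neg D) \<in> br \<pi>" if "D \<in> N" for D
      proof (rule ccontr)
        assume "Inst b1 (Neg D) \<notin> br \<pi>"
        then have "applicable K Ag Al a\<^sub>0 C\<^sub>0 \<pi> RNegEx
            [Inst a1 (Neg (Ex r D)), Rel r a1 b1] [{Inst b1 (Neg D)}]"
          using a1[OF that] b1 op by (auto simp: applicable_def blocked_def intro: tab_rule.NegEx)
        then have "rank REx \<le> rank RNegEx"
          using nxt Ex by (auto simp: next_rule_def)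
        moreover have "rank RNegEx < rank REx"
          using priority by (simp add: priority_order_def)
        ultimately show False by simp
      qed
      then have "blocked a\<^sub>0 C\<^sub>0 \<pi> \<rho> Pr"
        using b1 Ex unfolding blocked_def N_def by blast
      with nblk show False ..
    qed
    moreover have "known_inds \<pi>' \<subseteq> known_inds \<pi> \<union> {b, b}"
      using P(1)[OF a] by (auto simp: ki concl)
    ultimately show ?thesis by blast
  next
    case (IotaG1_new C b a D)
    with Pr have "Inst a (Iota C D) \<in> br \<pi>" by simp
    then have "C \<in> cl" by (auto dest!: P cl_dest intro: cl_intros)
    moreover have concl: "Cs ! i = {Inst b C, Inst b D}" using i IotaG1_new by simp
    ultimately have "KIotaG C \<in> keys \<pi>' - keys \<pi>"
      using IotaG1_new by (auto simp: keys_iff br')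
    moreover have "known_inds \<pi>' \<subseteq> known_inds \<pi> \<union> {b, b}"
      by (auto simp: ki concl)
    ultimately show ?thesis by blast
  next
    case (NegIotaG b b' a C D a' E)
    with Pr have a: "Inst a (Neg (Iota C D)) \<in> br \<pi>" and a': "Inst a' E \<in> br \<pi>" by simp_all
    show ?thesis
    \<comment> \<open>Alternatives are counted from 0, so this is the third one, the only one with
      fresh individuals.\<close>
    proof (cases "i = 2")
      case True
      from a have "C \<in> cl" by (auto dest!: P cl_dest intro: cl_intros)
      moreover have "third_taken \<pi>' C"
        using True NegIotaG by (auto simp: third_taken_def \<pi>'_def)
      moreover have "\<not> third_taken \<pi> C"
        using nblk NegIotaG by (auto simp: blocked_def)
      ultimately have "KNegIotaG C \<in> keys \<pi>' - keys \<pi>"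
        by (simp add: keys_iff)
      moreover have "known_inds \<pi>' \<subseteq> known_inds \<pi> \<union> {b, b'}"
        using True NegIotaG by (auto simp: ki)
      ultimately show ?thesis by blast
    next
      case False
      with i NegIotaG have "i = 0 \<or> i = 1" by auto
      then show ?thesis using P(1)[OF a'] NegIotaG by (auto simp: ki)
    qed
  next
    case (NegIotaL_new C b a)
    with Pr have a: "Inst a (Neg (Loc C)) \<in> br \<pi>" by simp
    show ?thesis
    proof (cases "i = 0")
      case True
      then show ?thesis using P(1)[OF a] NegIotaL_new by (auto simp: ki)
    next
      case False
      with i NegIotaL_new have i1: "i = 1" by auto
      from a have "C \<in> cl" by (auto dest!: P cl_dest intro: cl_intros)
      then have "KNegIotaL C \<in> keys \<pi>' - keys \<pi>"
        using i1 NegIotaL_new by (auto simp: keys_iff br')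
      moreover have "known_inds \<pi>' \<subseteq> known_inds \<pi> \<union> {b, b}"
        using i1 P(1)[OF a] NegIotaL_new by (auto simp: ki)
      ultimately show ?thesis by blast
    qed
  \<comment> \<open>The remaining rules reuse individuals of their premises or, in
    \<open>IotaG1_old\<close>, an individual already on the branch.\<close>
  qed (rule disjI1, (use i Pr in \<open>auto simp: ki less_Suc_eq dest!: P\<close>)[1])+
qed

section \<open>Bounds along a branch\<close>

lemma tableau_snocD:
  assumes "\<pi> @ [s] \<in> T"
  obtains \<rho> Pr Cs i where "\<pi> \<in> T" "next_rule rank K Ag Al a\<^sub>0 C\<^sub>0 \<pi> \<rho> Pr Cs"
    "i < length Cs" "s = Step \<rho> Pr i (Cs ! i)"
proof -
  have "\<pi> \<in> T" using tableau assms unfolding tableau_def by blast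
  moreover have s: "s \<in> children T \<pi>" using assms by (simp add: children_def)
  ultimately obtain \<rho> Pr Cs where nxt: "next_rule rank K Ag Al a\<^sub>0 C\<^sub>0 \<pi> \<rho> Pr Cs"
    and ch: "children T \<pi> = {Step \<rho> Pr i (Cs ! i) | i. i < length Cs}"
    using tableau unfolding tableau_def by blast
  from s obtain i where "i < length Cs" "s = Step \<rho> Pr i (Cs ! i)"
    unfolding ch by auto
  with that[OF \<open>\<pi> \<in> T\<close> nxt] show ?thesis .
qed

lemma finite_children:
  assumes "\<pi> \<in> T" shows "finite (children T \<pi>)"
proof (cases "children T \<pi> = {}")
  case False
  with tableau assms obtain \<rho> Pr Cs where
    "children T \<pi> = {Step \<rho> Pr i (Cs ! i) | i. i < length Cs}"
    unfolding tableau_def by blast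
  then show ?thesis by simp
qed simp

lemma branch_ok: "\<pi> \<in> T \<Longrightarrow> br \<pi> \<subseteq> ok_assertions (known_inds \<pi>)"
proof (induction \<pi> rule: rev_induct)
  case Nil
  then show ?case
    by (auto simp: known_inds_def intro!: cl_intros(1) seeds_base) (simp add: seeds_def)
next
  case (snoc s \<pi>)
  from snoc.prems obtain \<rho> Pr Cs i where *: "\<pi> \<in> T"
    "next_rule rank K Ag Al a\<^sub>0 C\<^sub>0 \<pi> \<rho> Pr Cs" "i < length Cs" "s = Step \<rho> Pr i (Cs ! i)"
    by (rule tableau_snocD)
  have ki: "known_inds (\<pi> @ [s]) = known_inds \<pi> \<union> \<Union> (inds ` (Cs ! i))"
    using * by (auto simp: known_inds_def)
  have "Cs ! i \<subseteq> ok_assertions (known_inds (\<pi> @ [s]))"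
    unfolding ki using * snoc.IH
    by (intro ok_step[where B = "br \<pi>" and \<rho> = \<rho> and Pr = Pr and Cs = Cs])
      (auto simp: next_rule_def applicable_def)
  moreover have "ok_assertions (known_inds \<pi>) \<subseteq> ok_assertions (known_inds (\<pi> @ [s]))"
    unfolding ki ok_assertions_def by blast
  ultimately show ?case
    using snoc.IH[OF *(1)] * by auto
qed

text \<open>The number of keys acts as a potential: a step that brings in at most two individuals
  pays for them with at least one new key. The \<open>Suc\<close> accounts for the root individual
  \<open>a\<^sub>0\<close>.\<close>

lemma card_known_inds:
  "\<pi> \<in> T \<Longrightarrow> finite (known_inds \<pi>) \<and>
     card (known_inds \<pi>) \<le> Suc (card (ontology_inds K)) + 2 * card (keys \<pi>)"
proof (induction \<pi> rule: rev_induct)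
  case Nil
  have "known_inds [] = insert a\<^sub>0 (ontology_inds K)"
    by (auto simp: known_inds_def)
  then show ?case
    using finite_ontology_inds by (auto simp: card_insert_if)
next
  case (snoc s \<pi>)
  from snoc.prems obtain \<rho> Pr Cs i where *: "\<pi> \<in> T"
    "next_rule rank K Ag Al a\<^sub>0 C\<^sub>0 \<pi> \<rho> Pr Cs" "i < length Cs" "s = Step \<rho> Pr i (Cs ! i)"
    by (rule tableau_snocD)
  note IH = snoc.IH[OF *(1)]
  have fin: "finite (keys (\<pi> @ [s]))"
    by (rule finite_subset[OF keys_subset finite_all_keys])
  from inds_step[OF *(2,3) branch_ok[OF *(1)]]
  consider "known_inds (\<pi> @ [s]) \<subseteq> known_inds \<pi>"
    | b b' k where "known_inds (\<pi> @ [s]) \<subseteq> known_inds \<pi> \<union> {b, b'}"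
        "k \<in> keys (\<pi> @ [s]) - keys \<pi>"
    unfolding *(4) by blast
  then show ?case
  proof cases
    case 1
    then have "finite (known_inds (\<pi> @ [s]))" "card (known_inds (\<pi> @ [s])) \<le> card (known_inds \<pi>)"
      using IH by (auto intro: finite_subset card_mono)
    moreover have "card (keys \<pi>) \<le> card (keys (\<pi> @ [s]))"
      by (rule card_mono[OF fin keys_mono])
    ultimately show ?thesis using IH by linarith
  next
    case 2
    have "card (known_inds (\<pi> @ [s])) \<le> card (known_inds \<pi> \<union> {b, b'})"
      using 2 IH by (intro card_mono) auto
    also have "\<dots> \<le> card (known_inds \<pi>) + card {b, b'}"
      by (rule card_Un_le)
    also have "\<dots> \<le> card (known_inds \<pi>) + 2"
      by (simp add: card_insert_if)
    finally have "card (known_inds (\<pi> @ [s])) \<le> card (known_inds \<pi>) + 2" .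
    moreover have "card (keys \<pi>) < card (keys (\<pi> @ [s]))"
      using 2 keys_mono by (intro psubset_card_mono[OF fin]) blast
    moreover have "finite (known_inds (\<pi> @ [s]))"
      using 2 IH by (auto intro: finite_subset)
    ultimately show ?thesis using IH by linarith
  qed
qed

section \<open>Height and levels of the tree\<close>

lemma finite_ok_assertions: "finite I \<Longrightarrow> finite (ok_assertions I)"
  using ontology by (simp add: ok_assertions_def finite_clos finite_base_roles)

text \<open>An explicit bound, monotone in \<open>card I\<close>, is wanted because the individuals
  vary from node to node while the height bound must be uniform.\<close>

lemma card_ok_assertions:
  assumes "finite I"
  shows "card (ok_assertions I) \<le> card I * card cl + card rl * (card I * card I) + 1"
proof -
  have "card (case_prod Inst ` (I \<times> cl) :: ('c, 'r, 'i) assertion set) \<le> card (I \<times> cl)"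
    using assms ontology by (intro card_image_le) (simp add: finite_clos)
  moreover have "card ((\<lambda>(r, a, b). Rel r a b) ` (rl \<times> I \<times> I) :: ('c, 'r, 'i) assertion set)
      \<le> card (rl \<times> I \<times> I)"
    using assms ontology by (intro card_image_le) (simp add: finite_base_roles)
  ultimately show ?thesis
    unfolding ok_assertions_def card_cartesian_product
    by (intro order.trans[OF card_Un_le] add_mono) simp_all
qed

text \<open>A rule applies only if none of its alternatives is already contained in the branch, so
  each step adds an assertion. The inequality is strict because the root already carries
  one.\<close>

lemma length_less_card_branch: "\<pi> \<in> T \<Longrightarrow> length \<pi> < card (br \<pi>)"
proof (induction \<pi> rule: rev_induct)
  case (snoc s \<pi>)
  from snoc.prems obtain \<rho> Pr Cs i where *: "\<pi> \<in> T"
    "next_rule rank K Ag Al a\<^sub>0 C\<^sub>0 \<pi> \<rho> Pr Cs" "i < length Cs" "s = Step \<rho> Pr i (Cs ! i)"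
    by (rule tableau_snocD)
  have "finite (br (\<pi> @ [s]))"
    using branch_ok[OF snoc.prems] card_known_inds[OF snoc.prems] finite_ok_assertions
    by (meson finite_subset)
  moreover have "\<not> Cs ! i \<subseteq> br \<pi>"
    using * by (simp add: next_rule_def applicable_def)
  ultimately have "card (br \<pi>) < card (br (\<pi> @ [s]))"
    using *(4) by (intro psubset_card_mono) auto
  with snoc.IH[OF *(1)] show ?case by simp
qed simp

lemma length_bounded: "\<exists>n. \<forall>\<pi>\<in>T. length \<pi> \<le> n"
proof -
  \<comment> \<open>Replacing the keys of a node by the full supply \<open>all_keys\<close> makes
    the bound on individuals independent of the node.\<close>
  define m where "m = Suc (card (ontology_inds K)) + 2 * card all_keys"
  have "length \<pi> \<le> m * card cl + card rl * (m * m) + 1" if \<pi>: "\<pi> \<in> T" for \<pi>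
  proof -
    note I = card_known_inds[OF \<pi>]
    have "card (keys \<pi>) \<le> card all_keys"
      by (rule card_mono[OF finite_all_keys keys_subset])
    with I have m: "card (known_inds \<pi>) \<le> m" by (simp add: m_def)
    have "length \<pi> \<le> card (br \<pi>)"
      using length_less_card_branch[OF \<pi>] by simp
    also have "\<dots> \<le> card (ok_assertions (known_inds \<pi>))"
      using I by (intro card_mono branch_ok \<pi> finite_ok_assertions) simp
    also have "\<dots> \<le> card (known_inds \<pi>) * card cl
        + card rl * (card (known_inds \<pi>) * card (known_inds \<pi>)) + 1"
      using I by (intro card_ok_assertions) simp
    also have "\<dots> \<le> m * card cl + card rl * (m * m) + 1"
      using m by (intro add_mono mult_mono) simp_all
    finally show ?thesis .
  qed
  then show ?thesis by blast
qed

text \<open>Each node of length \<open>Suc n\<close> is a child of a node one level up, and every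
  node has finitely many children. With bounded height, the tree is then a finite union of finite
  levels.\<close>

lemma finite_level: "finite {\<pi> \<in> T. length \<pi> = n}"
proof (induction n)
  case (Suc n)
  let ?L = "{\<pi> \<in> T. length \<pi> = n}"
  have "{\<pi> \<in> T. length \<pi> = Suc n} \<subseteq> (\<Union>\<pi>\<in>?L. (\<lambda>s. \<pi> @ [s]) ` children T \<pi>)"
  proof
    fix \<pi> assume \<pi>: "\<pi> \<in> {\<pi> \<in> T. length \<pi> = Suc n}"
    then obtain \<pi>' s where eq: "\<pi> = \<pi>' @ [s]" "length \<pi>' = n"
      by (auto simp: length_Suc_conv_rev)
    with \<pi> have "\<pi>' \<in> ?L" by (auto elim: tableau_snocD)
    with eq \<pi> show "\<pi> \<in> (\<Union>\<pi>\<in>?L. (\<lambda>s. \<pi> @ [s]) ` children T \<pi>)"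
      by (auto simp: children_def)
  qed
  then show ?case
    by (rule finite_subset) (use Suc in \<open>auto intro: finite_children\<close>)
qed simp

lemma finite_tableau: "finite T"
proof -
  obtain n where n: "\<forall>\<pi>\<in>T. length \<pi> \<le> n" using length_bounded by blast
  then have "T = (\<Union>k\<le>n. {\<pi> \<in> T. length \<pi> = k})" by auto
  moreover have "finite (\<Union>k\<le>n. {\<pi> \<in> T. length \<pi> = k})" by (simp add: finite_level)
  ultimately show ?thesis by simp
qed

end

theorem theorem8:
  fixes C\<^sub>0 :: "('c, 'r) concept"
    and K :: "('c, 'r, 'i::linorder) ontology"
    and a\<^sub>0 :: 'i
    and Ag Al :: "('c, 'r) concept \<Rightarrow> 'c"
    and rank :: "rule_name \<Rightarrow> nat"
    and T :: "('c, 'r, 'i) node set"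
  assumes "infinite (UNIV :: 'i set)"
    and "is_ontology K"
    and "a\<^sub>0 \<notin> ontology_inds K"
    and "fresh_names C\<^sub>0 K Ag Al"
    and "priority_order rank"
    and "tableau rank K Ag Al a\<^sub>0 C\<^sub>0 T"
    and "exhaustive K Ag Al a\<^sub>0 C\<^sub>0 T"
  shows "finite T"
proof -
  interpret alci_tableau C\<^sub>0 K a\<^sub>0 Ag Al rank T
    using assms by unfold_locales
  show ?thesis by (rule finite_tableau)
qed

end
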